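(* Let $n$, $m$ and $t$ be positive integers with $m\le \left\lfloor \frac{n}{t+1}\right\rfloor$. Then $$p^{(t)}(n,m)=p^{(t)}(n-m,m)+p^{(t)}(n,m+1).$$
   Context: A partition of a positive integer $n$ is a finite sequence $\lambda=[\lambda_1,\lambda_2,\ldots,\lambda_k]$ of positive integers with $\lambda_1\ge\lambda_2\ge\cdots\ge\lambda_k$ and $\lambda_1+\cdots+\lambda_k=n$; we write $\lambda\vdash n$. For positive integers $n,m,t$, $p^{(t)}(n,m)$ denotes the number of partitions $\lambda\vdash n$ all of whose parts are at least $m$ and which satisfy $\lambda_1\ge t\cdot\lambda_2$. The one-part partition $[n]$ is considered to satisfy this condition, so it is counted whenever $n\ge m$. *)

theory Defs
  imports Main
begin

definition is_partition :: "nat \<Rightarrow> nat list \<Rightarrow> bool" where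
  "is_partition n xs \<longleftrightarrow>
     sorted_wrt (\<ge>) xs \<and> (\<forall>x\<in>set xs. 0 < x) \<and> sum_list xs = n"

text \<open>
  Lists are indexed from 0, so \<open>xs ! 0\<close> and \<open>xs ! 1\<close> are the parts $\lambda_1$ and $\lambda_2$.
  The condition on them is vacuous for the one-part partition \<open>[n]\<close>.
\<close>

definition ratio_partitions :: "nat \<Rightarrow> nat \<Rightarrow> nat \<Rightarrow> nat list set" where
  "ratio_partitions t n m =
     {xs. is_partition n xs \<and> (\<forall>x\<in>set xs. m \<le> x) \<and>
          (2 \<le> length xs \<longrightarrow> t * xs ! 1 \<le> xs ! 0)}"

definition num_ratio_partitions :: "nat \<Rightarrow> nat \<Rightarrow> nat \<Rightarrow> nat" where
  "num_ratio_partitions t n m = card (ratio_partitions t n m)"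

end

theory Submission
  imports Defs
begin

text \<open>
  A partition counted on the left either has all parts at least \<open>m + 1\<close> or has smallest part \<open>m\<close>.
  Deleting one copy of \<open>m\<close> at the end of the latter gives a partition of \<open>n - m\<close>. Conversely,
  appending \<open>m\<close> can only affect the ratio condition when it becomes the second part, that is for
  \<open>[n - m]\<close>, and there the hypothesis on \<open>m\<close> says precisely that \<open>t * m \<le> n - m\<close>.
\<close>

lemma length_le_sum_list_of_pos:
  fixes xs :: "nat list"
  assumes "\<forall>x\<in>set xs. 0 < x"
  shows "length xs \<le> sum_list xs"
  using assms by (induction xs) auto

text \<open>Finiteness is needed for \<open>card\<close> to be additive. Positivity of the parts is
  what bounds the length; trailing zeros would give infinitely many lists.\<close>

lemma finite_partitions: "finite {xs. is_partition n xs}"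
proof (rule finite_subset)
  show "{xs. is_partition n xs} \<subseteq> {xs. set xs \<subseteq> {..n} \<and> length xs \<le> n}"
    using length_le_sum_list_of_pos by (auto simp: is_partition_def member_le_sum_list)
qed (rule finite_lists_length_le, simp)

lemma finite_ratio_partitions: "finite (ratio_partitions t n m)"
  by (rule finite_subset[OF _ finite_partitions[of n]]) (auto simp: ratio_partitions_def)

lemma append_in_ratio_partitions_iff:
  assumes "0 < m" and "(t + 1) * m \<le> n"
  shows "xs @ [m] \<in> ratio_partitions t n m \<longleftrightarrow> xs \<in> ratio_partitions t (n - m) m"
proof -
  have "m \<le> n" and "t * m \<le> n - m"
    using assms(2) by (simp_all add: algebra_simps)
  then show ?thesis
    using assms(1)
    \<comment> \<open>The rule splits into \<open>[]\<close>, \<open>[x]\<close> and longer lists: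
      the new \<open>m\<close> becomes the first, second or a later part. In \<open>[x]\<close>,
      \<open>x = n - m\<close>; \<open>m \<le> n\<close> keeps the subtraction from
      truncating.\<close>
    by (cases xs rule: remdups_adj.cases)
      (auto simp: ratio_partitions_def is_partition_def sorted_wrt_append)
qed

text \<open>The last part is the smallest, and \<open>m\<close> is both a lower bound and
  attained.\<close>

lemma ratio_partition_with_part_eq_append:
  assumes "xs \<in> ratio_partitions t n m" and "m \<in> set xs"
  obtains ys where "xs = ys @ [m]"
proof (cases xs rule: rev_cases)
  case Nil
  then show ?thesis using assms(2) by simp
next
  case (snoc ys z)
  then have "z = m"
    using assms by (auto simp: ratio_partitions_def is_partition_def sorted_wrt_append intro: antisym)
  then show ?thesis using snoc that by blast
qed

lemma ratio_partitions_split: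
  "ratio_partitions t n m =
     {xs \<in> ratio_partitions t n m. m \<in> set xs} \<union> ratio_partitions t n (m + 1)"
  by (auto simp: ratio_partitions_def Suc_le_eq le_less)

lemma ratio_partitions_with_part_eq_image:
  assumes "0 < m" and "(t + 1) * m \<le> n"
  shows "{xs \<in> ratio_partitions t n m. m \<in> set xs} =
           (\<lambda>xs. xs @ [m]) ` ratio_partitions t (n - m) m"
proof (intro equalityI subsetI)
  fix xs
  assume xs: "xs \<in> {xs \<in> ratio_partitions t n m. m \<in> set xs}"
  then obtain ys where "xs = ys @ [m]"
    using ratio_partition_with_part_eq_append by blast
  then show "xs \<in> (\<lambda>xs. xs @ [m]) ` ratio_partitions t (n - m) m"
    using xs append_in_ratio_partitions_iff[OF assms] by simp
qed (auto simp: append_in_ratio_partitions_iff[OF assms, simplified])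

theorem theorem1:
  fixes n m t :: nat
  assumes "0 < n" and "0 < m" and "0 < t"
    and "m \<le> n div (t + 1)"
  shows "num_ratio_partitions t n m = num_ratio_partitions t (n - m) m + num_ratio_partitions t n (m + 1)"
proof -
  let ?A = "{xs \<in> ratio_partitions t n m. m \<in> set xs}"
  have "(t + 1) * m \<le> n"
    using assms(4) by (simp add: less_eq_div_iff_mult_less_eq mult.commute)
  then have "card ?A = card (ratio_partitions t (n - m) m)"
    using assms(2) by (simp only: ratio_partitions_with_part_eq_image) (simp add: card_image inj_on_def)
  moreover have "card (?A \<union> ratio_partitions t n (m + 1)) =
      card ?A + card (ratio_partitions t n (m + 1))"
    \<comment> \<open>Disjoint: a part equal to \<open>m\<close> violates the bound
      \<open>m + 1\<close>.\<close>
    by (rule card_Un_disjoint) (auto simp: finite_ratio_partitions, auto simp: ratio_partitions_def)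
  ultimately show ?thesis
    unfolding num_ratio_partitions_def by (metis ratio_partitions_split)
qed

end
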